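(* Let $(X,\|\cdot\|_X)$ be a Banach space and let $I\in C^1(X,\mathbb{R})$ satisfy: (A1) $I(0)=0$, $I(u)$ is even in $u$ and bounded from below; (A2'') $I(u)$ satisfies the $(PS)_c$ condition for all $c\le 0$; (A3) for any $k\in\mathbb{N}$ there exists $A\in\mathcal{E}$ such that $\gamma(A)\ge k$ and $\sup_{u\in A}I(u)<0$. Then there exists a sequence $(u_j)_{j=1}^\infty\subset X$ of critical points of $I$ such that $$I(u_j)<0\ \text{ for all } j\in\mathbb{N},\qquad I(u_j)\to 0\ \text{ as } j\to\infty,\qquad \operatorname{dist}(u_j,\widehat K_0)\to 0\ \text{ as } j\to\infty.$$
   Context: $X$ is a real Banach space with dual $X^*$; $\mathbb{N}=\{1,2,\dots\}$. A critical point of $I$ is $u\in X$ with $I'(u)=0$. $(PS)_c$: for $c\in\mathbb{R}$, $I$ satisfies $(PS)_c$ if any sequence $(u_j)_{j=1}^\infty\subset X$ with $I(u_j)\to c$ and $\|I'(u_j)\|_{X^*}\to 0$ has a (norm-)convergent subsequence. $\mathcal{E}$ is the family of sets $A\subset X\setminus\{0\}$ that are closed (in $X$) and symmetric with respect to $0$. For $A\in\mathcal{E}$, the (Krasnosel'skii) genus $\gamma(A)$ is the smallest integer $n$ such that there exists an odd continuous map $\zeta\in C(A,\mathbb{R}^n\setminus\{0\})$; if no such map exists for any $n$, $\gamma(A)=\infty$; $\gamma(\emptyset)=0$. $K_0=\{u\in X: I'(u)=0,\ I(u)=0\}$ (which contains $0$), and $\widehat K_0$ is the connected component of $K_0$ containing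 $0$. $\operatorname{dist}(u,\widehat K_0)=\inf\{\|u-v\|_X: v\in\widehat K_0\}$. *)

theory Defs
  imports "HOL-Analysis.Analysis"
begin

text \<open>
  The dual space \<open>X\<^sup>*\<close> is the normed space \<open>'a \<Rightarrow>\<^sub>L real\<close> of bounded linear functionals with
  the operator norm. The map \<open>I'\<close> is the Frechet derivative of \<open>I\<close>; being uniquely
  determined by \<open>I\<close>, it is carried along as a second argument.
\<close>

definition C1_functional :: "('a::real_normed_vector \<Rightarrow> real) \<Rightarrow> ('a \<Rightarrow> 'a \<Rightarrow>\<^sub>L real) \<Rightarrow> bool" where
  "C1_functional I I' \<longleftrightarrow>
     (\<forall>u. (I has_derivative blinfun_apply (I' u)) (at u)) \<and> continuous_on UNIV I'"

definition critical_point :: "('a::real_normed_vector \<Rightarrow> 'a \<Rightarrow>\<^sub>L real) \<Rightarrow> 'a \<Rightarrow> bool" where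
  "critical_point I' u \<longleftrightarrow> I' u = 0"

definition palais_smale ::
  "('a::real_normed_vector \<Rightarrow> real) \<Rightarrow> ('a \<Rightarrow> 'a \<Rightarrow>\<^sub>L real) \<Rightarrow> real \<Rightarrow> bool" where
  "palais_smale I I' c \<longleftrightarrow>
     (\<forall>u :: nat \<Rightarrow> 'a.
        (\<lambda>j. I (u j)) \<longlonglongrightarrow> c \<longrightarrow> (\<lambda>j. norm (I' (u j))) \<longlonglongrightarrow> 0 \<longrightarrow>
        (\<exists>r. strict_mono r \<and> convergent (u \<circ> r)))"

definition sym_closed_sets :: "'a::real_normed_vector set set" where
  "sym_closed_sets = {A. closed A \<and> 0 \<notin> A \<and> (\<forall>u\<in>A. - u \<in> A)}"

text \<open>
  \<open>Euclidean_space n\<close> models the space of real \<open>n\<close>-tuples as the functions \<open>nat \<Rightarrow> real\<close> vanishing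
  at all indices \<open>\<ge> n\<close>, so its origin is \<open>\<lambda>_. 0\<close>.
\<close>

definition odd_map_to_punctured ::
  "'a::real_normed_vector set \<Rightarrow> nat \<Rightarrow> ('a \<Rightarrow> nat \<Rightarrow> real) \<Rightarrow> bool" where
  "odd_map_to_punctured A n \<zeta> \<longleftrightarrow>
     continuous_map (top_of_set A) (subtopology (Euclidean_space n) (- {\<lambda>_. 0})) \<zeta> \<and>
     (\<forall>u\<in>A. \<zeta> (- u) = (\<lambda>i. - \<zeta> u i))"

text \<open>
  On \<open>enat\<close> the infimum of a nonempty set is its least element, and the infimum of the empty set
  is \<open>\<infinity>\<close>. For \<open>n = 0\<close> the punctured space is empty, so the empty set, and only it, has genus 0.
\<close>

definition genus :: "'a::real_normed_vector set \<Rightarrow> enat" where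
  "genus A = Inf (enat ` {n. \<exists>\<zeta>. odd_map_to_punctured A n \<zeta>})"

definition K0 :: "('a::real_normed_vector \<Rightarrow> real) \<Rightarrow> ('a \<Rightarrow> 'a \<Rightarrow>\<^sub>L real) \<Rightarrow> 'a set" where
  "K0 I I' = {u. critical_point I' u \<and> I u = 0}"

definition K0_hat :: "('a::real_normed_vector \<Rightarrow> real) \<Rightarrow> ('a \<Rightarrow> 'a \<Rightarrow>\<^sub>L real) \<Rightarrow> 'a set" where
  "K0_hat I I' = connected_component_set (K0 I I') 0"

end

theory Submission
  imports Defs
begin

text \<open>
  Write \<open>I\<^sup>b\<close> for the sublevel set \<open>{u. I u \<le> b}\<close>, let \<open>Z\<close> be the set of critical points at level \<open>0\<close> and
  \<open>H\<close> its component containing \<open>0\<close>. Suppose that for some \<open>e > 0\<close> no critical point \<open>u\<close> satisfies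
  \<open>- e < I u < 0\<close> and \<open>dist(u, H) < e\<close>. The proof shows that then the genus of \<open>I\<^sup>b\<close> is bounded by one
  number \<open>M\<close> for all \<open>b < 0\<close>. Every symmetric set on which \<open>sup I < 0\<close> lies in such a sublevel set,
  so this contradicts the assumption that such sets have arbitrarily large genus.

  By the Palais-Smale condition \<open>Z\<close> is compact. In a compact Hausdorff space components are
  quasi-components, so \<open>Z\<close> has a relatively clopen part \<open>V\<close> with \<open>H \<subseteq> V\<close> that stays within distance \<open>e\<close>
  of \<open>H\<close> (\<open>component_clopen_nhd\<close>), and \<open>V\<close> can be made symmetric. Let \<open>C\<close> be the set of all other
  critical points at levels \<open>\<le> 0\<close>. Critical points at negative levels cannot accumulate at \<open>V\<close>,
  by the choice of \<open>e\<close>, so \<open>C\<close> is closed, hence compact; it is symmetric and omits \<open>0\<close>, so a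
  neighbourhood of \<open>C\<close> has finite genus \<open>n\<close>.

  All critical points at negative levels lie in \<open>C\<close>, and the slope of \<open>I\<close> is at least some \<open>c > 0\<close> on the
  shell \<open>r \<le> dist(u, C) \<le> 3 r\<close> at levels \<open>\<le> 0\<close>. Descending along an odd pseudo-gradient field therefore
  carries \<open>I\<^sup>b\<close>, for any \<open>b < 0\<close>, into the union of the sublevel set at level \<open>b - \<delta>\<close> and the
  \<open>3 r\<close>-neighbourhood of \<open>C\<close>, since crossing the shell costs a fixed amount of \<open>I\<close>; here \<open>\<delta>\<close> is proportional to \<open>c r\<close> and does not
  depend on \<open>b\<close>. Each such step adds at most \<open>n\<close> to the genus, and as \<open>I\<close> is bounded below, a number of
  steps independent of \<open>b\<close> reaches the empty set (\<open>sublevel_sets_uniformly_separated\<close>).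

  The deformation comes from iterating discrete steps \<open>u \<mapsto> u + D u\<close>, where \<open>D\<close> is an odd continuous
  field with \<open>I (u + t D u) \<le> I u - |I' u| |t D u| / 4\<close> for \<open>0 \<le> t \<le> 1\<close> (\<open>odd_descent_field\<close>). As long as the slope stays away
  from \<open>0\<close>, the steps are summable, so the iterates converge; by continuity the limit is a zero of \<open>D\<close>.
  Hence every orbit enters the open target region after finitely many steps, and damping the
  steps after that makes the number of moves locally bounded, so the resulting map is continuous
  (\<open>odd_deformation\<close>).
\<close>

section \<open>An odd norming selection on the dual space\<close>

text \<open>
  This is the \<open>\<sigma>\<close>-discrete refinement from A. H. Stone's proof that metric spaces are paracompact,
  with the vectors \<open>v i\<close> attached. Well-order the index set and label each covered point with the
  least \<open>i\<close> such that \<open>U i\<close> contains it. Call a point good at stage \<open>n\<close> if its ball of radius \<open>3 \<cdot> 2\<^sup>-\<^sup>n\<close>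
  lies in its labelled set. By minimality of labels, good points with different labels are at distance
  at least \<open>3 \<cdot> 2\<^sup>-\<^sup>n\<close>, so within distance \<open>2\<^sup>-\<^sup>n\<close> of the good points the label is locally constant.
  Each stage thus gives one continuous field, and the bound \<open>2\<^sup>-\<^sup>n\<close> on the weights makes the sum over
  all stages uniformly convergent.
\<close>

lemma sigma_discrete_selection:
  fixes U :: "'i \<Rightarrow> 'a::metric_space set" and v :: "'i \<Rightarrow> 'b::real_normed_vector"
  assumes openU: "\<And>i. open (U i)" and v1: "\<And>i. norm (v i) \<le> 1"
  obtains w :: "nat \<Rightarrow> 'a \<Rightarrow> real" and k :: "nat \<Rightarrow> 'a \<Rightarrow> 'i"
  where "\<And>n x. 0 \<le> w n x" "\<And>n x. w n x \<le> (1/2)^n"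
    "\<And>n x. w n x > 0 \<Longrightarrow> x \<in> U (k n x)"
    "\<And>x i. x \<in> U i \<Longrightarrow> \<exists>n. w n x > 0"
    "\<And>n. continuous_on UNIV (\<lambda>x. w n x *\<^sub>R v (k n x))"
proof -
  obtain r :: "'i rel" where r: "well_order_on UNIV r"
    using well_order_on by blast
  have wf: "wf (r - Id)" and lin: "linear_order_on UNIV r"
    using r by (auto simp: well_order_on_def)
  have least: "\<exists>i. x \<in> U i \<and> (\<forall>j. x \<in> U j \<longrightarrow> (i, j) \<in> r)" if "x \<in> U i0" for x i0
  proof -
    have "i0 \<in> {i. x \<in> U i}" using that by simp
    from wfE_min[OF wf this] obtain i where i: "x \<in> U i" "\<And>j. (j, i) \<in> r - Id \<Longrightarrow> x \<notin> U j"
      by (metis mem_Collect_eq)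
    then show ?thesis
      using lin by (metis DiffI UNIV_I linear_order_on_def order_on_defs(1) pair_in_Id_conv
          partial_order_on_def preorder_on_def refl_onD total_on_def)
  qed
  define lab where "lab x = (SOME i. x \<in> U i \<and> (\<forall>j. x \<in> U j \<longrightarrow> (i, j) \<in> r))" for x
  have lab: "x \<in> U (lab x)" "(lab x, i) \<in> r" if "x \<in> U i" for x i
    using someI_ex[OF least[OF that]] that unfolding lab_def by auto
  define e :: "nat \<Rightarrow> real" where "e n = (1/2)^n" for n
  have e0: "e n > 0" for n by (simp add: e_def)
  define E where "E n = {y. (\<exists>i. y \<in> U i) \<and> ball y (3 * e n) \<subseteq> U (lab y)}" for n
  have lab_eq: "lab y = lab z" if "y \<in> E n" "z \<in> E n" "dist y z < 3 * e n" for y z n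
  proof -
    have "(lab z, lab y) \<in> r" "(lab y, lab z) \<in> r"
      using that lab unfolding E_def by (auto simp: dist_commute subset_iff)
    then show ?thesis
      using lin by (auto simp: linear_order_on_def partial_order_on_def antisym_def)
  qed
  define w where "w n x = (if E n = {} then 0 else max 0 (e n - infdist x (E n)))" for n x
  define near where "near n x = (SOME y. y \<in> E n \<and> dist x y < e n)" for n x
  define k where "k n x = lab (near n x)" for n x
  have near: "near n x \<in> E n" "dist x (near n x) < e n" if "w n x > 0" for n x
  proof -
    have "E n \<noteq> {}" "infdist x (E n) < e n"
      using that by (auto simp: w_def split: if_splits)
    then have "\<exists>d\<in>dist x ` E n. d < e n"
      by (intro cInf_lessD) (auto simp: infdist_notempty)
    then have "\<exists>y. y \<in> E n \<and> dist x y < e n"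
      by blast
    from someI_ex[OF this] show "near n x \<in> E n" "dist x (near n x) < e n"
      by (auto simp: near_def)
  qed
  have cw: "continuous_on UNIV (w n)" for n
    unfolding w_def by (cases "E n = {}") (auto intro!: continuous_intros)
  have w0: "0 \<le> w n x" for n x by (simp add: w_def)
  have wle: "w n x \<le> (1/2)^n" for n x
    using infdist_nonneg[of x "E n"] by (simp add: w_def e_def)
  have inU: "x \<in> U (k n x)" if "w n x > 0" for n x
  proof -
    have "near n x \<in> E n" "dist (near n x) x < 3 * e n"
      using near[OF that] e0[of n] by (auto simp: dist_commute)
    then show ?thesis by (auto simp: E_def k_def)
  qed
  have pos: "\<exists>n. w n x > 0" if x: "x \<in> U i" for x i
  proof -
    obtain d where d: "d > 0" "ball x d \<subseteq> U (lab x)"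
      using openU lab(1)[OF x] open_contains_ball by blast
    obtain n where "(1/2::real)^n < d / 3"
      using real_arch_pow_inv[of "d/3" "1/2"] d by auto
    then have "x \<in> E n"
      using d x unfolding E_def e_def by force
    then have "w n x > 0" using e0[of n] by (auto simp: w_def)
    then show ?thesis by blast
  qed
  have cont: "continuous_on UNIV (\<lambda>x. w n x *\<^sub>R v (k n x))" for n
  proof -
    have "isCont (\<lambda>x. w n x *\<^sub>R v (k n x)) x" for x
    proof (cases "w n x > 0")
      case False
      then have wx: "w n x = 0" using w0[of n x] by simp
      have "(w n \<longlongrightarrow> w n x) (at x)"
        using cw[of n] by (auto simp: continuous_on_eq_continuous_at isCont_def)
      then have "(w n \<longlongrightarrow> 0) (at x)" by (simp add: wx)
      then have "((\<lambda>y. w n y *\<^sub>R v (k n y)) \<longlongrightarrow> 0) (at x)"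
      proof (rule Lim_null_comparison[rotated])
        show "\<forall>\<^sub>F y in at x. norm (w n y *\<^sub>R v (k n y)) \<le> w n y"
          using w0 v1 by (auto intro!: always_eventually mult_left_le)
      qed
      then show ?thesis by (simp add: isCont_def wx)
    next
      case True
      have ev1: "\<forall>\<^sub>F y in nhds x. w n y > 0"
        using eventually_nhds_in_open[OF open_Collect_less[OF continuous_on_const cw[of n], of 0], of x] True
        by simp
      have ev2: "\<forall>\<^sub>F y in nhds x. dist y x < e n"
        using e0[of n] by (auto simp: eventually_nhds_metric)
      have ev: "\<forall>\<^sub>F y in nhds x. w n y *\<^sub>R v (k n y) = w n y *\<^sub>R v (k n x)"
        using ev1 ev2
      proof eventually_elim
        case (elim y)
        have "dist (near n y) (near n x) < 3 * e n"
          using near(2)[OF True] near(2)[OF elim(1)] elim(2)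
            dist_triangle[of "near n y" "near n x" y] dist_triangle[of y "near n x" x]
          by (simp add: dist_commute)
        then show ?case
          using lab_eq[of "near n y" n "near n x"] near(1)[OF True] near(1)[OF elim(1)]
          by (simp add: k_def)
      qed
      have "continuous_on UNIV (\<lambda>y. w n y *\<^sub>R v (k n x))"
        by (intro continuous_intros cw)
      then have "isCont (\<lambda>y. w n y *\<^sub>R v (k n x)) x"
        by (simp add: continuous_on_eq_continuous_at)
      then show ?thesis
        using isCont_cong[OF ev] by blast
    qed
    then show ?thesis by (simp add: continuous_on_eq_continuous_at)
  qed
  show thesis
    using that[of w k] w0 wle inU pos cont by blast
qed

text \<open>
  Every \<open>f \<noteq> 0\<close> exceeds \<open>norm f / 2\<close> at some vector of norm at most \<open>1\<close>, and the same vector works for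
  all functionals near \<open>f\<close>. The condition \<open>norm f * w / 2 \<le> f v\<close>, with a weight \<open>w \<ge> norm v\<close>, is stable
  under sums, so the local choices can be added up with the weights of
  \<open>sigma_discrete_selection\<close>. Antisymmetrising the resulting field makes it odd and keeps the
  condition.
\<close>

lemma continuous_odd_norming_selection:
  obtains J :: "('a::banach \<Rightarrow>\<^sub>L real) \<Rightarrow> 'a"
  where "continuous_on UNIV J" "\<And>f. J (- f) = - J f"
    "\<And>f. f \<noteq> 0 \<Longrightarrow> J f \<noteq> 0"
    "\<And>f. blinfun_apply f (J f) \<ge> norm f * norm (J f) / 2"
proof -
  define v :: "'a \<Rightarrow> 'a" where "v i = (if norm i \<le> 1 then i else 0)" for i
  define U :: "'a \<Rightarrow> ('a \<Rightarrow>\<^sub>L real) set" where "U i = {f. norm f / 2 < blinfun_apply f (v i)}" for i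
  have v1: "norm (v i) \<le> 1" for i by (simp add: v_def)
  have oU: "open (U i)" for i
    unfolding U_def by (intro open_Collect_less continuous_intros) auto
  have cover: "\<exists>i. f \<in> U i" if "f \<noteq> 0" for f
  proof (rule ccontr)
    assume "\<nexists>i. f \<in> U i"
    then have le: "blinfun_apply f i \<le> norm f / 2" if "norm i \<le> 1" for i
      using that unfolding U_def v_def by (metis (mono_tags, lifting) mem_Collect_eq not_le)
    have "norm (blinfun_apply f x) \<le> norm f / 2 * norm x" for x
    proof (cases "x = 0")
      case False
      define y where "y = x /\<^sub>R norm x"
      have y: "norm y \<le> 1" "norm (- y) \<le> 1" "x = norm x *\<^sub>R y"
        using False by (simp_all add: y_def)
      have "blinfun_apply f x = norm x * blinfun_apply f y"
        using y(3) by (metis blinfun.scaleR_right real_scaleR_def)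
      moreover have "\<bar>blinfun_apply f y\<bar> \<le> norm f / 2"
        using le[OF y(1)] le[OF y(2)] by (simp only: blinfun.minus_right abs_le_iff)
      ultimately show ?thesis
        using mult_left_mono[of "\<bar>blinfun_apply f y\<bar>" "norm f / 2" "norm x"]
        by (simp add: abs_mult mult.commute)
    qed simp
    then have "norm f \<le> norm f / 2"
      by (intro norm_blinfun_bound) auto
    then show False using that by simp
  qed
  obtain w k where w0: "\<And>n x. 0 \<le> w n x" and wle: "\<And>n x. w n x \<le> (1/2)^n"
    and inU: "\<And>n x. w n x > 0 \<Longrightarrow> x \<in> U (k n x)"
    and pos: "\<And>x i. x \<in> U i \<Longrightarrow> \<exists>n. w n x > 0"
    and cont: "\<And>n. continuous_on UNIV (\<lambda>x. w n x *\<^sub>R v (k n x))"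
    using sigma_discrete_selection[of U v] oU v1 by blast
  have nle: "norm (w n f *\<^sub>R v (k n f)) \<le> w n f" for n f
    using w0[of n f] v1[of "k n f"] by (simp add: mult_left_le)
  have nle2: "norm (w n f *\<^sub>R v (k n f)) \<le> (1/2)^n" for n f
    using nle wle order_trans by blast
  have geo: "summable (\<lambda>n. (1/2::real)^n)" by simp
  have sumw: "summable (\<lambda>n. w n f)" for f
    by (rule summable_comparison_test[OF _ geo]) (use w0 wle in auto)
  have sumv: "summable (\<lambda>n. w n f *\<^sub>R v (k n f))" for f
    by (rule summable_comparison_test[OF _ geo]) (use nle2 in blast)
  define V where "V f = (\<Sum>n. w n f *\<^sub>R v (k n f))" for f
  have cV: "continuous_on UNIV V"
  proof (rule uniform_limit_theorem)
    show "uniform_limit UNIV (\<lambda>n f. \<Sum>i<n. w i f *\<^sub>R v (k i f)) V sequentially"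
      unfolding V_def by (rule Weierstrass_m_test[OF nle2 geo])
    show "\<forall>\<^sub>F n in sequentially. continuous_on UNIV (\<lambda>f. \<Sum>i<n. w i f *\<^sub>R v (k i f))"
      by (intro always_eventually allI continuous_on_sum cont)
  qed simp
  have normV: "norm (V f) \<le> (\<Sum>n. w n f)" for f
    unfolding V_def
    by (rule norm_suminf_le[OF nle sumw])
  have fV: "norm f / 2 * (\<Sum>n. w n f) \<le> blinfun_apply f (V f)" for f
  proof -
    have "blinfun_apply f (V f) = (\<Sum>n. blinfun_apply f (w n f *\<^sub>R v (k n f)))"
      unfolding V_def by (rule bounded_linear.suminf[OF blinfun.bounded_linear_right sumv])
    moreover have "norm f / 2 * (\<Sum>n. w n f) = (\<Sum>n. norm f / 2 * w n f)"
      by (rule suminf_mult[symmetric, OF sumw])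
    moreover have "(\<Sum>n. norm f / 2 * w n f) \<le> (\<Sum>n. blinfun_apply f (w n f *\<^sub>R v (k n f)))"
    proof (rule suminf_le)
      show "norm f / 2 * w n f \<le> blinfun_apply f (w n f *\<^sub>R v (k n f))" for n
        using inU[of n f] w0[of n f]
        by (cases "w n f > 0") (auto simp: U_def blinfun.scaleR_right mult.commute)
      show "summable (\<lambda>n. norm f / 2 * w n f)" by (rule summable_mult[OF sumw])
      show "summable (\<lambda>n. blinfun_apply f (w n f *\<^sub>R v (k n f)))"
        by (rule bounded_linear.summable[OF blinfun.bounded_linear_right sumv])
    qed
    ultimately show ?thesis by simp
  qed
  have posw: "(\<Sum>n. w n f) > 0" if f: "f \<noteq> 0" for f
  proof -
    obtain n where "w n f > 0" using cover[OF f] pos by blast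
    then show ?thesis using suminf_pos_iff[OF sumw w0] by blast
  qed
  have fV2: "norm f * norm (V f) / 2 \<le> blinfun_apply f (V f)" for f
    using fV[of f] mult_left_mono[OF normV[of f], of "norm f / 2"] by simp
  define J where "J f = V f - V (- f)" for f
  show thesis
  proof (rule that[of J])
    show "continuous_on UNIV J"
      unfolding J_def by (intro continuous_intros cV continuous_on_compose2[OF cV]) auto
    show "J (- f) = - J f" for f by (simp add: J_def)
    have m: "blinfun_apply f (- V (- f)) \<ge> norm f * norm (V (- f)) / 2" for f
      using fV2[of "- f"] by (simp add: blinfun.minus_left blinfun.minus_right)
    have a: "blinfun_apply f (J f) = blinfun_apply f (V f) + blinfun_apply f (- V (- f))" for f
      by (simp add: J_def blinfun.diff_right blinfun.minus_right)
    show "J f \<noteq> 0" if "f \<noteq> 0" for f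
    proof
      assume "J f = 0"
      then have "blinfun_apply f (V f) + blinfun_apply f (- V (- f)) = 0"
        using a[of f] by simp
      moreover have "blinfun_apply f (V f) > 0"
        using fV[of f] mult_pos_pos[OF _ posw[OF that], of "norm f / 2"] that by simp
      moreover have "blinfun_apply f (- V (- f)) \<ge> 0"
        by (rule order_trans[OF _ m]) simp
      ultimately show False by simp
    qed
    show "blinfun_apply f (J f) \<ge> norm f * norm (J f) / 2" for f
    proof -
      have "norm f * norm (J f) \<le> norm f * (norm (V f) + norm (V (- f)))"
        unfolding J_def by (intro mult_left_mono norm_triangle_ineq4) auto
      then show ?thesis
        using fV2[of f] m[of f] a[of f] by (simp add: distrib_left)
    qed
  qed
qed

section \<open>Odd descent fields of even functionals\<close>

lemma C1_functional_along_segment: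
  assumes "C1_functional I I'"
  obtains t where "0 \<le> t" "t \<le> 1" "I (u + h) - I u = blinfun_apply (I' (u + t *\<^sub>R h)) h"
proof -
  have der: "(I has_derivative blinfun_apply (I' u)) (at u)" for u
    using assms by (simp add: C1_functional_def)
  have "((\<lambda>t. I (u + t *\<^sub>R h)) has_derivative (\<lambda>s. blinfun_apply (I' (u + t *\<^sub>R h)) (s *\<^sub>R h)))
      (at t within {0..1})" for t
    by (rule has_derivative_compose[OF _ der, unfolded o_def]) (auto intro!: derivative_eq_intros)
  then have "\<exists>t\<in>{0..1}. I (u + 1 *\<^sub>R h) - I (u + 0 *\<^sub>R h)
      = (\<lambda>s. blinfun_apply (I' (u + t *\<^sub>R h)) (s *\<^sub>R h)) (1 - 0)"
    by (intro mvt_very_simple) auto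
  then show thesis using that by auto
qed

lemma C1_functional_deriv_odd:
  assumes C1: "C1_functional I I'" and even: "\<And>u. I (- u) = I u"
  shows "I' (- u) = - I' u"
proof -
  have der: "(I has_derivative blinfun_apply (I' u)) (at u)" for u
    using C1 by (simp add: C1_functional_def)
  have "((\<lambda>u. I (- u)) has_derivative (\<lambda>h. blinfun_apply (I' (- u)) (- h))) (at u)"
    by (rule has_derivative_compose[OF _ der]) (auto intro!: derivative_eq_intros)
  then have "(\<lambda>h. blinfun_apply (I' (- u)) (- h)) = blinfun_apply (I' u)"
    using has_derivative_unique[OF _ der] by (simp add: even)
  then have "blinfun_apply (I' (- u)) (- h) = blinfun_apply (I' u) h" for h
    by metis
  from this[of "- h" for h] show ?thesis
    by (intro blinfun_eqI) (simp add: blinfun.minus_left blinfun.minus_right)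
qed

text \<open>
  The largest radius up to \<open>1\<close> of a ball around \<open>u\<close> on which \<open>F\<close> varies by at most a quarter of its norm is
  \<open>1\<close>-Lipschitz in \<open>u\<close>, since a ball that works for \<open>u\<close> contains the correspondingly smaller ball around
  any nearby point. It serves as a continuous step length although \<open>F\<close> need not be uniformly
  continuous.
\<close>

lemma small_oscillation_radius:
  fixes F :: "'a::real_normed_vector \<Rightarrow> 'b::real_normed_vector"
  assumes contF: "continuous_on UNIV F" and odd: "\<And>u. F (- u) = - F u"
  obtains R :: "'a \<Rightarrow> real"
  where "continuous_on UNIV R" "\<And>u. R (- u) = R u" "\<And>u. 0 \<le> R u"
    "\<And>u. F u \<noteq> 0 \<Longrightarrow> R u > 0"
    "\<And>u x. dist u x < R u \<Longrightarrow> norm (F x - F u) \<le> norm (F u) / 4"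
proof -
  define G where "G u = {r. 0 \<le> r \<and> r \<le> 1 \<and>
      (\<forall>x\<in>ball u r. \<forall>y\<in>ball u r. 4 * norm (F y - F x) \<le> norm (F x))}" for u
  define R where "R u = Sup (G u)" for u
  have G0: "0 \<in> G u" for u by (simp add: G_def)
  have bdd: "bdd_above (G u)" for u by (intro bdd_aboveI[of _ 1]) (simp add: G_def)
  have le: "r \<le> R u" if "r \<in> G u" for r u
    unfolding R_def by (rule cSup_upper[OF that bdd])
  have lip: "R u \<le> R w + dist u w" for u w
    unfolding R_def[of u]
  proof (rule cSup_least)
    show "G u \<noteq> {}" using G0 by blast
    fix r assume r: "r \<in> G u"
    show "r \<le> R w + dist u w"
    proof (cases "dist u w \<le> r")
      case True
      have "ball w (r - dist u w) \<subseteq> ball u r"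
      proof
        fix x assume "x \<in> ball w (r - dist u w)"
        then show "x \<in> ball u r" using dist_triangle[of u x w] by simp
      qed
      moreover have "r - dist u w \<le> 1"
        using r zero_le_dist[of u w] unfolding G_def by (simp del: zero_le_dist)
      ultimately have "r - dist u w \<in> G w"
        using r True unfolding G_def by (simp add: subset_iff)
      from le[OF this] show ?thesis by simp
    next
      case False
      then show ?thesis using le[OF G0, of w] by simp
    qed
  qed
  have lip': "dist (R u) (R w) \<le> dist u w" for u w
    using lip[of u w] lip[of w u] by (simp add: dist_real_def dist_commute abs_le_iff)
  have neg: "G (- u) \<subseteq> G u" for u
  proof
    fix r assume r: "r \<in> G (- u)"
    have b: "- x \<in> ball (- u) r" if "x \<in> ball u r" for x
      using that by (simp add: dist_norm norm_minus_commute)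
    have "4 * norm (F y - F x) \<le> norm (F x)" if "x \<in> ball u r" "y \<in> ball u r" for x y
    proof -
      have "4 * norm (F (- y) - F (- x)) \<le> norm (F (- x))"
        using r b[OF that(1)] b[OF that(2)] unfolding G_def by blast
      then show ?thesis by (simp add: odd norm_minus_commute)
    qed
    then show "r \<in> G u" using r by (simp add: G_def)
  qed
  show thesis
  proof (rule that[of R])
    show "continuous_on UNIV R"
      unfolding continuous_on_iff
    proof (intro ballI allI impI)
      fix x :: 'a and d :: real assume "d > 0"
      then show "\<exists>b>0. \<forall>y\<in>UNIV. dist y x < b \<longrightarrow> dist (R y) (R x) < d"
        using le_less_trans[OF lip'] by (intro exI[of _ d]) simp
    qed
    show "R (- u) = R u" for u
      using neg[of u] neg[of "- u"] by (auto simp: R_def)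
    show "0 \<le> R u" for u using le[OF G0] .
    show "R u > 0" if "F u \<noteq> 0" for u
    proof -
      have "isCont F u" using contF by (simp add: continuous_on_eq_continuous_at)
      moreover have "norm (F u) / 9 > 0" using that by simp
      ultimately obtain d where d: "d > 0" "\<And>x. dist x u < d \<Longrightarrow> dist (F x) (F u) < norm (F u) / 9"
        unfolding continuous_at_eps_delta by meson
      have "4 * norm (F y - F x) \<le> norm (F x)" if "x \<in> ball u (min d 1)" "y \<in> ball u (min d 1)" for x y
      proof -
        have "norm (F x - F u) < norm (F u) / 9" "norm (F y - F u) < norm (F u) / 9"
          using that d(2)[of x] d(2)[of y] by (auto simp: dist_norm norm_minus_commute)
        moreover have "norm (F y - F x) \<le> norm (F y - F u) + norm (F x - F u)"
          using norm_triangle_ineq4[of "F y - F u" "F x - F u"] by simp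
        moreover have "norm (F u) \<le> norm (F x) + norm (F x - F u)"
          using norm_triangle_ineq4[of "F x" "F x - F u"] by simp
        ultimately show ?thesis by simp
      qed
      then have "min d 1 \<in> G u" using d(1) by (auto simp: G_def)
      from le[OF this] show ?thesis using d(1) by simp
    qed
    show "norm (F x - F u) \<le> norm (F u) / 4" if ux: "dist u x < R u" for u x
    proof -
      have "G u \<noteq> {}" using G0 by blast
      then obtain r where r: "r \<in> G u" "dist u x < r"
        using less_cSupD[of "G u" "dist u x"] ux unfolding R_def by blast
      then have "u \<in> ball u r" "x \<in> ball u r"
        using zero_le_dist[of u x] by (auto simp del: zero_le_dist)
      then have "4 * norm (F x - F u) \<le> norm (F u)"
        using r(1) unfolding G_def by blast
      then show ?thesis by simp
    qed
  qed
qed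

text \<open>
  Move against \<open>J (I' u)\<close>, where \<open>J\<close> is the norming selection, by less than the radius on which \<open>I'\<close>
  varies by at most \<open>norm (I' u) / 4\<close>. The norming factor \<open>1/2\<close> then leaves a descent rate of at least
  \<open>norm (I' u) / 4\<close> along the whole segment. As \<open>I\<close> is even, \<open>I'\<close> and hence the field are odd.
\<close>

lemma odd_descent_field:
  fixes I :: "'a::banach \<Rightarrow> real"
  assumes C1: "C1_functional I I'" and even: "\<And>u. I (- u) = I u"
  obtains D :: "'a \<Rightarrow> 'a"
  where "continuous_on UNIV D" "\<And>u. D (- u) = - D u" "\<And>u. D u = 0 \<Longrightarrow> I' u = 0"
    "\<And>u t. 0 \<le> t \<Longrightarrow> t \<le> 1 \<Longrightarrow> I (u + t *\<^sub>R D u) \<le> I u - norm (I' u) / 4 * norm (t *\<^sub>R D u)"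
proof -
  have contI': "continuous_on UNIV I'" using C1 by (simp add: C1_functional_def)
  have odd: "I' (- u) = - I' u" for u using C1_functional_deriv_odd[OF C1 even] .
  obtain J :: "('a \<Rightarrow>\<^sub>L real) \<Rightarrow> 'a" where J: "continuous_on UNIV J" "\<And>f. J (- f) = - J f"
    "\<And>f. f \<noteq> 0 \<Longrightarrow> J f \<noteq> 0" "\<And>f. blinfun_apply f (J f) \<ge> norm f * norm (J f) / 2"
    using continuous_odd_norming_selection by blast
  obtain R :: "'a \<Rightarrow> real" where R: "continuous_on UNIV R" "\<And>u. R (- u) = R u" "\<And>u. 0 \<le> R u"
    "\<And>u. I' u \<noteq> 0 \<Longrightarrow> R u > 0"
    "\<And>u x. dist u x < R u \<Longrightarrow> norm (I' x - I' u) \<le> norm (I' u) / 4"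
    using small_oscillation_radius[OF contI' odd] by blast
  have J0: "J 0 = 0" using J(2)[of 0] scaleR_2[of "J 0"] by (simp add: eq_neg_iff_add_eq_0)
  define a where "a u = R u / (1 + norm (J (I' u)))" for u
  define D where "D u = - (a u *\<^sub>R J (I' u))" for u
  have a0: "0 \<le> a u" for u using R(3)[of u] by (simp add: a_def)
  have pos: "1 + norm x > 0" for x :: 'a by (smt (verit) norm_ge_zero)
  have nz: "1 + norm x \<noteq> 0" for x :: 'a using pos[of x] by linarith
  show thesis
  proof (rule that[of D])
    have cJ: "continuous_on UNIV (\<lambda>u. J (I' u))"
      by (rule continuous_on_compose2[OF J(1) contI']) auto
    show "continuous_on UNIV D"
      unfolding D_def a_def by (intro continuous_intros cJ R(1)) (use nz in auto)
    show "D (- u) = - D u" for u by (simp add: D_def a_def odd J(2) R(2))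
    show "I' u = 0" if "D u = 0" for u
    proof (rule ccontr)
      assume "I' u \<noteq> 0"
      then show False
        using that J(3)[of "I' u"] R(4)[of u] nz[of "J (I' u)"] by (simp add: D_def a_def)
    qed
    fix u and t :: real assume t: "0 \<le> t" "t \<le> 1"
    obtain s where s: "0 \<le> s" "s \<le> 1"
      "I (u + t *\<^sub>R D u) - I u = blinfun_apply (I' (u + s *\<^sub>R t *\<^sub>R D u)) (t *\<^sub>R D u)"
      using C1_functional_along_segment[OF C1] by blast
    show "I (u + t *\<^sub>R D u) \<le> I u - norm (I' u) / 4 * norm (t *\<^sub>R D u)"
    proof (cases "I' u = 0")
      case True
      then show ?thesis by (simp add: D_def J0)
    next
      case False
      have nD: "norm (D u) = a u * norm (J (I' u))" using a0[of u] by (simp add: D_def)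
      have "norm (D u) < R u"
        using R(4)[OF False] pos[of "J (I' u)"] by (simp add: nD a_def field_simps)
      moreover have "norm (s *\<^sub>R t *\<^sub>R D u) \<le> norm (D u)"
        using s t mult_le_one[of s t] mult_right_mono[of "s * t" 1 "norm (D u)"]
        by (simp add: mult.assoc)
      ultimately have "dist u (u + s *\<^sub>R t *\<^sub>R D u) < R u" by (simp add: dist_norm)
      then have osc: "norm (I' (u + s *\<^sub>R t *\<^sub>R D u) - I' u) \<le> norm (I' u) / 4" by (rule R(5))
      define h where "h = t *\<^sub>R D u"
      have "blinfun_apply (I' (u + s *\<^sub>R h) - I' u) h \<le> norm (I' (u + s *\<^sub>R h) - I' u) * norm h"
        using norm_blinfun[of "I' (u + s *\<^sub>R h) - I' u" h] by simp
      also have "\<dots> \<le> norm (I' u) / 4 * norm h"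
        using osc by (intro mult_right_mono) (auto simp: h_def)
      finally have 1: "blinfun_apply (I' (u + s *\<^sub>R h)) h \<le> blinfun_apply (I' u) h + norm (I' u) / 4 * norm h"
        by (simp add: blinfun.diff_left)
      have "blinfun_apply (I' u) h = - (t * a u * blinfun_apply (I' u) (J (I' u)))"
        by (simp add: h_def D_def blinfun.scaleR_right blinfun.minus_right)
      also have "\<dots> \<le> - (t * a u * (norm (I' u) * norm (J (I' u)) / 2))"
        using mult_left_mono[OF J(4)[of "I' u"], of "t * a u"] t a0[of u] by simp
      also have "\<dots> = - (norm (I' u) / 2 * norm h)"
        using t by (simp add: h_def nD)
      finally show ?thesis using 1 s(3) by (simp add: h_def)
    qed
  qed
qed

section \<open>Genus bounds from globally defined odd functions\<close>

text \<open>
  An upper bound on the genus by globally defined functions. Requiring the components of the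
  odd map to be defined on the whole space makes subadditivity a concatenation of families.
\<close>

definition odd_separated :: "'a::real_normed_vector set \<Rightarrow> nat \<Rightarrow> bool" where
  "odd_separated A n \<longleftrightarrow> (\<exists>f :: nat \<Rightarrow> 'a \<Rightarrow> real.
     (\<forall>i<n. continuous_on UNIV (f i) \<and> (\<forall>u. f i (- u) = - f i u)) \<and>
     (\<forall>u\<in>A. \<exists>i<n. f i u \<noteq> 0))"

lemma odd_separated_imp_genus_le:
  assumes "odd_separated A n" and sym: "\<And>u. u \<in> A \<Longrightarrow> - u \<in> A"
  shows "genus A \<le> enat n"
proof -
  obtain f :: "nat \<Rightarrow> 'a \<Rightarrow> real" where f: "\<And>i. i < n \<Longrightarrow> continuous_on UNIV (f i)"
    "\<And>i u. i < n \<Longrightarrow> f i (- u) = - f i u" "\<And>u. u \<in> A \<Longrightarrow> \<exists>i<n. f i u \<noteq> 0"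
    using assms(1) unfolding odd_separated_def by metis
  define z where "z u = (\<lambda>i. if i < n then f i u else 0)" for u
  have "continuous_map (top_of_set A) (Euclidean_space n) z"
    unfolding z_def
    by (subst continuous_map_componentwise_Euclidean_space[where f="\<lambda>u i. f i u"])
      (auto intro: continuous_on_subset[OF f(1)])
  moreover have "z u \<noteq> (\<lambda>_. 0)" if "u \<in> A" for u
    using f(3)[OF that] unfolding z_def by (metis (full_types))
  ultimately have "odd_map_to_punctured A n z"
    unfolding odd_map_to_punctured_def
    by (auto simp: continuous_map_in_subtopology z_def f(2) fun_eq_iff)
  then have "enat n \<in> enat ` {n. \<exists>z. odd_map_to_punctured A n z}"
    by (intro imageI CollectI exI)
  then show ?thesis unfolding genus_def by (rule Inf_lower)
qed

lemma odd_separated_empty: "odd_separated {} 0"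
  by (simp add: odd_separated_def)

lemma odd_separated_Un:
  assumes "odd_separated A m" "odd_separated B n"
  shows "odd_separated (A \<union> B) (m + n)"
proof -
  obtain f :: "nat \<Rightarrow> 'a \<Rightarrow> real" where f: "\<And>i. i < m \<Longrightarrow> continuous_on UNIV (f i)"
    "\<And>i u. i < m \<Longrightarrow> f i (- u) = - f i u" "\<And>u. u \<in> A \<Longrightarrow> \<exists>i<m. f i u \<noteq> 0"
    using assms(1) unfolding odd_separated_def by metis
  obtain g :: "nat \<Rightarrow> 'a \<Rightarrow> real" where g: "\<And>i. i < n \<Longrightarrow> continuous_on UNIV (g i)"
    "\<And>i u. i < n \<Longrightarrow> g i (- u) = - g i u" "\<And>u. u \<in> B \<Longrightarrow> \<exists>i<n. g i u \<noteq> 0"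
    using assms(2) unfolding odd_separated_def by metis
  define h where "h i = (if i < m then f i else g (i - m))" for i
  have "\<exists>i<m + n. h i u \<noteq> 0" if u: "u \<in> A \<union> B" for u
  proof (cases "u \<in> A")
    case True
    then obtain i where "i < m" "f i u \<noteq> 0" using f(3) by blast
    then show ?thesis by (intro exI[of _ i]) (simp add: h_def)
  next
    case False
    then obtain i where "i < n" "g i u \<noteq> 0" using g(3) u by blast
    then show ?thesis by (intro exI[of _ "m + i"]) (simp add: h_def)
  qed
  then show ?thesis
    unfolding odd_separated_def using f g by (intro exI[of _ h]) (auto simp: h_def)
qed

lemma odd_separated_vimage:
  assumes B: "odd_separated B n" and cont: "continuous_on UNIV \<eta>"
    and odd: "\<And>u. \<eta> (- u) = - \<eta> u" and sub: "\<And>u. u \<in> A \<Longrightarrow> \<eta> u \<in> B"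
  shows "odd_separated A n"
proof -
  obtain f :: "nat \<Rightarrow> 'a \<Rightarrow> real" where f: "\<And>i. i < n \<Longrightarrow> continuous_on UNIV (f i)"
    "\<And>i u. i < n \<Longrightarrow> f i (- u) = - f i u" "\<And>u. u \<in> B \<Longrightarrow> \<exists>i<n. f i u \<noteq> 0"
    using B unfolding odd_separated_def by metis
  have "continuous_on UNIV (\<lambda>u. f i (\<eta> u))" if "i < n" for i
    by (rule continuous_on_compose2[OF f(1)[OF that] cont]) simp
  then show ?thesis
    unfolding odd_separated_def using f(2,3) sub
    by (intro exI[of _ "\<lambda>i u. f i (\<eta> u)"]) (auto simp: odd)
qed

lemma odd_separated_subset:
  "odd_separated B n \<Longrightarrow> A \<subseteq> B \<Longrightarrow> odd_separated A n"
  by (erule odd_separated_vimage[where \<eta>="\<lambda>u. u"]) (auto intro: continuous_on_id)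

text \<open>
  For \<open>x \<noteq> 0\<close> the difference of the tent functions of radius \<open>norm x\<close> at \<open>x\<close> and at \<open>- x\<close> is odd and does
  not vanish at \<open>x\<close>, hence not near \<open>x\<close>. Finitely many of these have no common zero near a compact set.
\<close>

lemma compact_odd_separated_nhd:
  fixes C :: "'a::real_normed_vector set"
  assumes C: "compact C" "0 \<notin> C"
  obtains n W where "open W" "C \<subseteq> W" "odd_separated W n"
proof -
  \<comment> \<open>odd in \<open>u\<close>; nonzero at \<open>u = x\<close> because the tent at \<open>- x\<close> vanishes there\<close>
  define \<phi> where "\<phi> x u = max 0 (norm x - dist u x) - max 0 (norm x - dist u (- x))" for x u :: 'a
  have cont: "continuous_on UNIV (\<phi> x)" for x
    unfolding \<phi>_def by (intro continuous_intros)
  have odd: "\<phi> x (- u) = - \<phi> x u" for x u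
  proof -
    have "dist (- u) x = dist u (- x)" "dist (- u) (- x) = dist u x"
      using norm_minus_cancel[of "u + x"] norm_minus_cancel[of "u - x"] by (simp_all add: dist_norm)
    then show ?thesis by (simp add: \<phi>_def)
  qed
  have "\<exists>D\<subseteq>C. finite D \<and> C \<subseteq> (\<Union>x\<in>D. {u. \<phi> x u \<noteq> 0})"
  proof (rule compactE_image[OF C(1)])
    show "open {u. \<phi> x u \<noteq> 0}" if "x \<in> C" for x
      by (intro open_Collect_neq cont continuous_on_const)
    have "\<phi> x x \<noteq> 0" if "x \<in> C" for x
    proof -
      have "dist x (- x) = 2 * norm x"
        using norm_scaleR[of 2 x] by (simp add: dist_norm scaleR_2)
      then show ?thesis using that C(2) by (auto simp: \<phi>_def)
    qed
    then show "C \<subseteq> (\<Union>x\<in>C. {u. \<phi> x u \<noteq> 0})" by blast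
  qed blast
  then obtain D where D: "finite D" "C \<subseteq> (\<Union>x\<in>D. {u. \<phi> x u \<noteq> 0})" by blast
  obtain xs where xs: "set xs = D" using finite_list[OF D(1)] by blast
  define W where "W = (\<Union>x\<in>D. {u. \<phi> x u \<noteq> 0})"
  show thesis
  proof (rule that[of W "length xs"])
    show "open W" unfolding W_def
      by (intro open_UN ballI open_Collect_neq cont continuous_on_const)
    show "C \<subseteq> W" using D(2) by (simp add: W_def)
    have "\<exists>i<length xs. \<phi> (xs ! i) u \<noteq> 0" if "u \<in> W" for u
      using that unfolding W_def xs[symmetric] by (auto simp: in_set_conv_nth)
    then show "odd_separated W (length xs)"
      unfolding odd_separated_def
      by (intro exI[of _ "\<lambda>i. \<phi> (xs ! i)"]) (auto intro: cont odd)
  qed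
qed

section \<open>Odd deformations by damped descent\<close>

text \<open>
  The second component accumulates the values of \<open>h\<close> along the orbit. The step length stays full
  as long as this sum is \<open>0\<close>, and once the sum is positive the step vanishes from the stage
  at which \<open>n\<close> times the sum reaches \<open>1\<close>.
\<close>

primrec damped_descent ::
  "('a::real_normed_vector \<Rightarrow> 'a) \<Rightarrow> ('a \<Rightarrow> real) \<Rightarrow> nat \<Rightarrow> 'a \<Rightarrow> 'a \<times> real" where
  "damped_descent D h 0 u = (u, h u)"
| "damped_descent D h (Suc n) u =
     (let (x, a) = damped_descent D h n u; y = x + max 0 (1 - real n * a) *\<^sub>R D x
      in (y, a + h y))"

text \<open>
  The target region consists of the points with \<open>g < r\<close> or with level below \<open>b - c * (s - r)\<close>. An
  orbit starting at a level \<open>\<le> b\<close> that never meets it takes full steps forever; the rate \<open>\<alpha>\<close> bounds its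
  length, so it converges, and its limit is a zero of \<open>D\<close> with \<open>g \<ge> r\<close>, which is impossible. Damping
  triggered by a positive sum of \<open>h\<close> stops all orbits near a given one after a common number of
  steps, so the final position is locally a finite iterate, hence continuous.

  After the region is reached, the orbit may still move, but \<open>g + I / c\<close> does not increase while
  \<open>g \<le> s\<close>, because \<open>g\<close> grows by at most the length of a step. Leaving \<open>{u. g u \<le> s}\<close> from
  \<open>{u. g u < r}\<close> therefore takes the level below \<open>b - c * (s - r)\<close>. This uses only \<open>c\<close>, whereas \<open>\<alpha>\<close>, which
  may degenerate as \<open>b\<close> varies, enters only in the convergence.
\<close>

lemma odd_deformation:
  fixes I g :: "'a::banach \<Rightarrow> real" and D :: "'a \<Rightarrow> 'a"
  assumes contI: "continuous_on UNIV I" and evenI: "\<And>u. I (- u) = I u"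
    and bdd: "\<And>u. m \<le> I u"
    and lipg: "\<And>u v. g u \<le> g v + dist u v" and eveng: "\<And>u. g (- u) = g u"
    and contD: "continuous_on UNIV D" and oddD: "\<And>u. D (- u) = - D u"
    and alpha: "\<alpha> > 0" and desc: "\<And>u t. I u \<le> b \<Longrightarrow> 0 \<le> t \<Longrightarrow> t \<le> 1 \<Longrightarrow>
      I (u + t *\<^sub>R D u) \<le> I u - \<alpha> * norm (t *\<^sub>R D u)"
    and c: "c > 0" and desc_near: "\<And>u t. I u \<le> b \<Longrightarrow> g u \<le> s \<Longrightarrow> 0 \<le> t \<Longrightarrow> t \<le> 1 \<Longrightarrow>
      I (u + t *\<^sub>R D u) \<le> I u - c * norm (t *\<^sub>R D u)"
    and stuck: "\<And>u. I u \<le> b \<Longrightarrow> D u = 0 \<Longrightarrow> g u < r" and rs: "r < s"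
  obtains \<eta> where "continuous_on UNIV \<eta>" "\<And>u. \<eta> (- u) = - \<eta> u"
    "\<And>u. I u \<le> b \<Longrightarrow> I (\<eta> u) \<le> b - c * (s - r) \<or> g (\<eta> u) \<le> s"
proof -
  define \<delta> where "\<delta> = c * (s - r)"
  have \<delta>: "\<delta> > 0" using c rs by (simp add: \<delta>_def)
  \<comment> \<open>positive exactly on the target region and above level \<open>b\<close>; the last term lets the orbits of points above level \<open>b\<close> stop too, so that the map is defined and continuous on the whole space\<close>
  define h where "h u = max 0 (r - g u) + max 0 ((b - \<delta>) - I u) + max 0 (I u - b)" for u
  have contg: "continuous_on UNIV g"
    unfolding continuous_on_iff
  proof (intro ballI allI impI)
    fix x :: 'a and d :: real assume "d > 0"
    moreover have "dist (g y) (g x) \<le> dist y x" for y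
      using lipg[of y x] lipg[of x y] by (simp add: dist_real_def dist_commute abs_le_iff)
    ultimately show "\<exists>e>0. \<forall>y\<in>UNIV. dist y x < e \<longrightarrow> dist (g y) (g x) < d"
      by (meson le_less_trans)
  qed
  have conth: "continuous_on UNIV h"
    unfolding h_def by (intro continuous_intros contg contI)
  have h0: "0 \<le> h u" for u by (simp add: h_def)
  have evenh: "h (- u) = h u" for u by (simp add: h_def evenI eveng)
  define x where "x n u = fst (damped_descent D h n u)" for n u
  define a where "a n u = snd (damped_descent D h n u)" for n u
  define \<theta> where "\<theta> n u = max 0 (1 - real n * a n u)" for n u
  have x0: "x 0 u = u" and a0: "a 0 u = h u" for u by (simp_all add: x_def a_def)
  have xS: "x (Suc n) u = x n u + \<theta> n u *\<^sub>R D (x n u)" for n u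
    by (simp add: x_def a_def \<theta>_def Let_def case_prod_beta)
  have aS: "a (Suc n) u = a n u + h (x (Suc n) u)" for n u
    by (simp add: x_def a_def Let_def case_prod_beta)
  have cont: "continuous_on UNIV (x n) \<and> continuous_on UNIV (a n)" for n
  proof (induction n)
    case 0
    have "x 0 = (\<lambda>u. u)" "a 0 = h" by (auto simp: x0 a0)
    then show ?case using conth by simp
  next
    case (Suc n)
    have "continuous_on UNIV (\<lambda>u. x n u + \<theta> n u *\<^sub>R D (x n u))"
      unfolding \<theta>_def using Suc
      by (intro continuous_intros continuous_on_compose2[OF contD]) auto
    then have 1: "continuous_on UNIV (x (Suc n))" by (simp add: xS[abs_def])
    have "continuous_on UNIV (\<lambda>u. a n u + h (x (Suc n) u))"
      using Suc 1 by (intro continuous_intros continuous_on_compose2[OF conth]) auto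
    then show ?case using 1 by (simp add: aS[abs_def])
  qed
  have sym: "x n (- u) = - x n u \<and> a n (- u) = a n u" for n u
  proof (induction n)
    case (Suc n)
    have "x (Suc n) (- u) = - x (Suc n) u" by (simp add: xS \<theta>_def Suc oddD)
    then show ?case by (simp add: aS Suc evenh)
  qed (simp add: x0 a0 evenh)
  have hle: "h (x n u) \<le> a n u \<and> 0 \<le> a n u" for n u
    by (induction n) (use h0 in \<open>auto simp: a0 x0 aS add_nonneg_nonneg\<close>)
  have amono: "a n u \<le> a k u" if "n \<le> k" for n k u
    using that by (induction rule: dec_induct) (use h0 in \<open>auto simp: aS intro: add_increasing2\<close>)
  have th: "0 \<le> \<theta> n u" "\<theta> n u \<le> 1" for n u
    using hle[of n u] by (simp_all add: \<theta>_def)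
  have Idec: "I (x n u) \<le> b" if "I u \<le> b" for n u
  proof (induction n)
    case (Suc n)
    have "0 \<le> \<alpha> * norm (\<theta> n u *\<^sub>R D (x n u))" using alpha by simp
    then show ?case using desc[OF Suc th[of n u]] Suc by (simp add: xS)
  qed (use that in \<open>simp add: x0\<close>)
  have reach: "\<exists>n. h (x n u) > 0" for u
  proof (rule ccontr)
    assume "\<nexists>n. h (x n u) > 0"
    then have hz: "h (x n u) = 0" for n using h0[of "x n u"] by (meson antisym not_le)
    have az: "a n u = 0" for n
      by (induction n) (use hz[of 0] hz in \<open>auto simp: a0 aS x0\<close>)
    have Iu: "I u \<le> b" using hz[of 0] by (auto simp: h_def x0 max_def split: if_splits)
    have step: "x (Suc n) u = x n u + D (x n u)" for n by (simp add: xS \<theta>_def az)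
    have dec: "norm (D (x n u)) \<le> (I (x n u) - I (x (Suc n) u)) / \<alpha>" for n
      using desc[OF Idec[OF Iu], of 1 n] alpha by (simp add: step field_simps)
    have part: "(\<Sum>i<n. norm (D (x i u))) \<le> (I u - I (x n u)) / \<alpha>" for n
    proof (induction n)
      case (Suc n)
      then show ?case using dec[of n] by (simp add: diff_divide_distrib)
    qed (simp add: x0)
    have "(\<Sum>i<n. norm (D (x i u))) \<le> (I u - m) / \<alpha>" for n
      using part[of n] divide_right_mono[of "I u - I (x n u)" "I u - m" \<alpha>] bdd[of "x n u"] alpha by simp
    then have sm: "summable (\<lambda>i. norm (D (x i u)))"
      by (intro summableI_nonneg_bounded) auto
    then have smD: "summable (\<lambda>i. D (x i u))" by (rule summable_norm_cancel)
    have xsum: "x n u = u + (\<Sum>i<n. D (x i u))" for n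
      by (induction n) (simp_all add: x0 step add.assoc)
    define p where "p = u + (\<Sum>i. D (x i u))"
    have "(\<lambda>n. u + (\<Sum>i<n. D (x i u))) \<longlonglongrightarrow> p"
      unfolding p_def by (intro tendsto_intros summable_LIMSEQ smD)
    then have lim: "(\<lambda>n. x n u) \<longlonglongrightarrow> p"
      by (simp only: xsum[symmetric])
    have "(\<lambda>n. D (x n u)) \<longlonglongrightarrow> D p"
      by (rule continuous_on_tendsto_compose[OF contD lim]) auto
    then have Dp: "D p = 0"
      using summable_LIMSEQ_zero[OF smD] LIMSEQ_unique by blast
    have "(\<lambda>n. I (x n u)) \<longlonglongrightarrow> I p"
      by (rule continuous_on_tendsto_compose[OF contI lim]) auto
    then have Ip: "I p \<le> b"
      by (rule LIMSEQ_le_const2) (use Idec[OF Iu] in blast)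
    have "(\<lambda>n. g (x n u)) \<longlonglongrightarrow> g p"
      by (rule continuous_on_tendsto_compose[OF contg lim]) auto
    moreover have "r \<le> g (x n u)" for n
      using hz[of n] by (auto simp: h_def max_def split: if_splits)
    ultimately have "r \<le> g p" by (intro LIMSEQ_le_const) auto
    then show False using stuck[OF Ip Dp] by simp
  qed
  have stop: "\<exists>N. (\<exists>k\<le>N. h (x k u) > 0) \<and>
      (\<forall>\<^sub>F w in nhds u. \<forall>n\<ge>N. x n w = x N w)" for u
  proof -
    obtain k where k: "h (x k u) > 0" using reach by blast
    then have ak: "a k u > 0" using hle[of k u] by linarith
    define d where "d = a k u / 2"
    have d: "d > 0" using ak by (simp add: d_def)
    obtain N0 :: nat where N0: "1 / d < N0" using reals_Archimedean2 by blast
    define N where "N = max N0 k"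
    have "\<forall>\<^sub>F w in nhds u. a k w > d"
      using eventually_nhds_in_open[OF open_Collect_less[OF continuous_on_const conjunct2[OF cont[of k]], of d], of u]
        ak by (simp add: d_def)
    then have "\<forall>\<^sub>F w in nhds u. \<forall>n\<ge>N. x n w = x N w"
    proof eventually_elim
      case (elim w)
      have zero: "\<theta> n w = 0" if "n \<ge> N" for n
      proof -
        have "d \<le> a n w" using elim amono[of k n w] that by (simp add: N_def)
        moreover have "1 / d \<le> real n" using N0 that by (simp add: N_def)
        ultimately have "1 / d * d \<le> real n * a n w"
          using d by (intro mult_mono) auto
        then show ?thesis using d by (simp add: \<theta>_def)
      qed
      show ?case
      proof (intro allI impI)
        fix n assume "n \<ge> N"
        then show "x n w = x N w"
          by (induction rule: dec_induct) (simp_all add: xS zero)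
      qed
    qed
    moreover have "k \<le> N" by (simp add: N_def)
    ultimately show ?thesis using k by blast
  qed
  define \<eta> where "\<eta> u = lim (\<lambda>n. x n u)" for u
  have eta: "\<eta> u = x N u" if "\<forall>n\<ge>N. x n u = x N u" for u N
    unfolding \<eta>_def
  proof (intro limI tendsto_eventually)
    show "\<forall>\<^sub>F n in sequentially. x n u = x N u"
      using that unfolding eventually_sequentially by blast
  qed
  show thesis
  proof (rule that[of \<eta>])
    have "isCont \<eta> u" for u
    proof -
      obtain N where "\<forall>\<^sub>F w in nhds u. \<forall>n\<ge>N. x n w = x N w" using stop by blast
      then have "\<forall>\<^sub>F w in nhds u. \<eta> w = x N w"
        by eventually_elim (rule eta)
      then have "isCont \<eta> u = isCont (x N) u" by (rule isCont_cong)
      then show ?thesis using cont[of N] by (simp add: continuous_on_eq_continuous_at)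
    qed
    then show "continuous_on UNIV \<eta>" by (simp add: continuous_on_eq_continuous_at)
    show "\<eta> (- u) = - \<eta> u" for u
    proof -
      obtain N where "\<forall>\<^sub>F w in nhds u. \<forall>n\<ge>N. x n w = x N w" using stop by blast
      then have N: "\<forall>n\<ge>N. x n u = x N u" by (rule eventually_nhds_x_imp_x)
      then have "\<forall>n\<ge>N. x n (- u) = x N (- u)" using sym by metis
      from eta[OF this] show ?thesis by (simp only: eta[OF N] sym)
    qed
    fix u assume Iu: "I u \<le> b"
    \<comment> \<open>an invariant of the orbit from the moment it meets the target region\<close>
    define Q where "Q y \<longleftrightarrow> I y \<le> b - \<delta> \<or> g y + I y / c \<le> r + b / c" for y
    have near: "g y \<le> s" if "Q y" "\<not> I y \<le> b - \<delta>" for y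
    proof -
      have "g y \<le> r + (b - I y) / c" using that by (simp add: Q_def diff_divide_distrib)
      moreover have "(b - I y) / c \<le> s - r"
        using that(2) c by (simp add: \<delta>_def field_simps)
      ultimately show ?thesis by simp
    qed
    have Qstep: "Q (x (Suc n) u)" if Q: "Q (x n u)" for n
    proof (cases "I (x n u) \<le> b - \<delta>")
      case True
      have "0 \<le> \<alpha> * norm (\<theta> n u *\<^sub>R D (x n u))" using alpha by simp
      then show ?thesis
        using desc[OF Idec[OF Iu] th[of n u], of n] True by (simp add: Q_def xS)
    next
      case False
      let ?d = "norm (\<theta> n u *\<^sub>R D (x n u))"
      have "c * ?d \<le> I (x n u) - I (x (Suc n) u)"
        using desc_near[OF Idec[OF Iu] near[OF Q False] th[of n u]] by (simp add: xS)
      then have "?d \<le> I (x n u) / c - I (x (Suc n) u) / c"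
        using c by (simp add: field_simps)
      moreover have "g (x (Suc n) u) \<le> g (x n u) + ?d"
        using lipg[of "x (Suc n) u" "x n u"] by (simp add: xS dist_norm)
      ultimately show ?thesis using Q False by (auto simp: Q_def)
    qed
    obtain N k where N: "\<forall>\<^sub>F w in nhds u. \<forall>n\<ge>N. x n w = x N w" and k: "k \<le> N" "h (x k u) > 0"
      using stop by blast
    have "r > g (x k u) \<or> b - \<delta> > I (x k u)"
      using k(2) Idec[OF Iu, of k] by (auto simp: h_def max_def split: if_splits)
    then have "Q (x k u)"
      using divide_right_mono[OF Idec[OF Iu, of k], of c] c by (auto simp: Q_def)
    with k(1) have "Q (x N u)"
      by (induction rule: dec_induct) (auto intro: Qstep)
    moreover have "\<eta> u = x N u" using eventually_nhds_x_imp_x[OF N] by (rule eta)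
    ultimately show "I (\<eta> u) \<le> b - c * (s - r) \<or> g (\<eta> u) \<le> s"
      using near[of "\<eta> u"] by (auto simp: \<delta>_def)
  qed
qed

section \<open>Consequences of the Palais-Smale condition\<close>

text \<open>
  The levels lie in a compact interval, so some subsequence of them converges to a level \<open>c \<le> 0\<close>,
  where the Palais-Smale condition applies.
\<close>

lemma palais_smale_subsequence:
  fixes I :: "'a::real_normed_vector \<Rightarrow> real"
  assumes bdd: "\<And>u. m \<le> I u" and PS: "\<And>c. c \<le> 0 \<Longrightarrow> palais_smale I I' c"
    and le: "\<And>n. I (u n) \<le> 0" and lim: "(\<lambda>n. norm (I' (u n))) \<longlonglongrightarrow> 0"
  obtains r p where "strict_mono (r :: nat \<Rightarrow> nat)" "(u \<circ> r) \<longlonglongrightarrow> p"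
proof -
  have "\<forall>n. I (u n) \<in> {m..0}" using bdd le by auto
  then obtain c r1 where r1: "c \<in> {m..0}" "strict_mono (r1 :: nat \<Rightarrow> nat)" "((\<lambda>n. I (u n)) \<circ> r1) \<longlonglongrightarrow> c"
    using compact_Icc[of m 0] unfolding compact_def by metis
  have "((\<lambda>n. norm (I' (u n))) \<circ> r1) \<longlonglongrightarrow> 0" by (rule LIMSEQ_subseq_LIMSEQ[OF lim r1(2)])
  then obtain r2 where r2: "strict_mono (r2 :: nat \<Rightarrow> nat)" "convergent ((u \<circ> r1) \<circ> r2)"
    using PS[of c] r1 unfolding palais_smale_def
    by (auto simp: o_def dest!: spec[of _ "\<lambda>j. u (r1 j)"])
  then obtain p where "((u \<circ> r1) \<circ> r2) \<longlonglongrightarrow> p" by (auto simp: convergent_def)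
  then show thesis
    using that[of "r1 \<circ> r2" p] strict_mono_o[OF r1(2) r2(1)] by (simp add: o_assoc)
qed

lemma slope_bounded_away_from_zero:
  fixes I :: "'a::real_normed_vector \<Rightarrow> real"
  assumes C1: "C1_functional I I'" and bdd: "\<And>u. m \<le> I u"
    and PS: "\<And>c. c \<le> 0 \<Longrightarrow> palais_smale I I' c"
    and F: "closed F" "\<And>u. u \<in> F \<Longrightarrow> I u \<le> 0" "\<And>u. u \<in> F \<Longrightarrow> I' u \<noteq> 0"
  shows "\<exists>c>0. \<forall>u\<in>F. c \<le> norm (I' u)"
proof (rule ccontr)
  assume neg: "\<not> ?thesis"
  have "\<exists>u\<in>F. norm (I' u) < 1 / real (Suc n)" for n
  proof -
    have "1 / real (Suc n) > 0" by simp
    then show ?thesis using neg by (meson not_le)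
  qed
  then obtain u where u: "\<And>n. u n \<in> F" "\<And>n. norm (I' (u n)) < 1 / real (Suc n)" by metis
  have lim: "(\<lambda>n. norm (I' (u n))) \<longlonglongrightarrow> 0"
    by (rule real_tendsto_sandwich[OF _ _ tendsto_const LIMSEQ_inverse_real_of_nat])
      (use u(2) in \<open>auto intro!: always_eventually less_imp_le simp: inverse_eq_divide\<close>)
  obtain r p where r: "strict_mono (r :: nat \<Rightarrow> nat)" "(u \<circ> r) \<longlonglongrightarrow> p"
    using palais_smale_subsequence[OF bdd PS F(2)[OF u(1)] lim] by blast
  have "p \<in> F" by (rule closed_sequentially[OF F(1) _ r(2)]) (simp add: u(1))
  moreover have "(\<lambda>n. I' ((u \<circ> r) n)) \<longlonglongrightarrow> I' p"
    using C1 by (intro continuous_on_tendsto_compose[OF _ r(2)]) (auto simp: C1_functional_def)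
  then have "(\<lambda>n. norm (I' ((u \<circ> r) n))) \<longlonglongrightarrow> norm (I' p)" by (rule tendsto_norm)
  moreover have "(\<lambda>n. norm (I' ((u \<circ> r) n))) \<longlonglongrightarrow> 0"
    using LIMSEQ_subseq_LIMSEQ[OF lim r(1)] by (simp add: o_def)
  ultimately show False using F(3)[of p] LIMSEQ_unique by fastforce
qed

lemma compact_critical_set:
  fixes I :: "'a::real_normed_vector \<Rightarrow> real"
  assumes bdd: "\<And>u. m \<le> I u" and PS: "\<And>c. c \<le> 0 \<Longrightarrow> palais_smale I I' c"
    and F: "closed F" "\<And>u. u \<in> F \<Longrightarrow> I u \<le> 0" "\<And>u. u \<in> F \<Longrightarrow> I' u = 0"
  shows "compact F"
  unfolding compact_def
proof (intro allI impI)
  fix u :: "nat \<Rightarrow> 'a" assume u: "\<forall>n. u n \<in> F"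
  then have "(\<lambda>n. norm (I' (u n))) \<longlonglongrightarrow> 0" by (simp add: F(3))
  then obtain r p where r: "strict_mono (r :: nat \<Rightarrow> nat)" "(u \<circ> r) \<longlonglongrightarrow> p"
    using palais_smale_subsequence[OF bdd PS F(2)] u by blast
  moreover have "p \<in> F" by (rule closed_sequentially[OF F(1) _ r(2)]) (simp add: u)
  ultimately show "\<exists>l\<in>F. \<exists>r. strict_mono r \<and> (u \<circ> r) \<longlonglongrightarrow> l" by blast
qed

section \<open>Components of compact sets\<close>

text \<open>
  Components of a compact Hausdorff space are quasi-components, and a quasi-component can be
  separated from any compact set disjoint from it by a clopen set. This is applied to the compact
  set \<open>K - W\<close>.
\<close>

lemma component_clopen_nhd:
  fixes K :: "'a::metric_space set"
  assumes K: "compact K" "x \<in> K" and W: "open W" "connected_component_set K x \<subseteq> W"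
  obtains U where "connected_component_set K x \<subseteq> U" "U \<subseteq> W" "U \<subseteq> K" "compact U" "compact (K - U)"
proof -
  let ?X = "top_of_set K"
  define C where "C = connected_component_set K x"
  have "C = connected_component_of_set ?X x"
    unfolding C_def connected_component_def connected_component_of_def
    by (auto simp: connectedin_subtopology)
  then have "C \<in> connected_components_of ?X"
    using K(2) by (auto simp: connected_components_of_def)
  moreover have "compact_space ?X" using K(1) by (simp add: compact_space_subtopology)
  moreover have "Hausdorff_space ?X" by (simp add: Hausdorff_space_subtopology)
  ultimately have "C \<in> quasi_components_of ?X"
    using quasi_eq_connected_components_of by blast
  moreover have "compactin ?X (K - W)"
    using compact_diff[OF K(1) W(1)] by (simp add: compactin_subtopology)
  moreover have "disjnt C (K - W)" using W(2) by (auto simp: C_def disjnt_def)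
  ultimately have "separated_between ?X C (K - W)"
    by (simp add: separated_between_quasi_component_compact)
  then obtain U V where U: "closedin ?X U" "closedin ?X V" "U \<union> V = K" "disjnt U V" "C \<subseteq> U" "K - W \<subseteq> V"
    unfolding separated_between_alt by auto
  have "K - U = V" using U by (auto simp: disjnt_def)
  moreover have "compact U" "compact V"
    using U(1,2) closedin_compact[OF K(1)] by auto
  ultimately show thesis
    using that[of U] U by (auto simp: C_def disjnt_def)
qed

section \<open>Sublevel sets and the critical set at level zero\<close>

text \<open>
  Induction over level strips of a height independent of \<open>b\<close>. By \<open>odd_deformation\<close>, one strip costs
  the \<open>n\<close> functions that separate a neighbourhood of \<open>C\<close>. Its height is determined by the slope on a
  shell around \<open>C\<close>. At levels \<open>\<le> 0\<close> the critical points off \<open>C\<close> lie in \<open>U\<close>, which the shell avoids, so this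
  slope bound holds at all levels up to \<open>0\<close> at once; the slope bound away from \<open>C\<close> at levels \<open>\<le> b\<close> may tend
  to \<open>0\<close> with \<open>b\<close> but does not affect the count.
\<close>

lemma sublevel_sets_uniformly_separated:
  fixes I :: "'a::banach \<Rightarrow> real"
  assumes C1: "C1_functional I I'" and even: "\<And>u. I (- u) = I u" and bdd: "\<And>u. m \<le> I u"
    and PS: "\<And>c. c \<le> 0 \<Longrightarrow> palais_smale I I' c"
    and C: "compact C" "0 \<notin> C" "\<And>u. u \<in> C \<Longrightarrow> - u \<in> C"
    and U: "compact U" "C \<inter> U = {}" "\<And>u. u \<in> U \<Longrightarrow> I u = 0"
    and crit: "\<And>u. I' u = 0 \<Longrightarrow> I u \<le> 0 \<Longrightarrow> u \<in> C \<union> U"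
  obtains M where "\<And>b. b < 0 \<Longrightarrow> odd_separated {u. I u \<le> b} M"
proof -
  have contI: "continuous_on UNIV I"
    using C1 by (auto simp: C1_functional_def continuous_on_eq_continuous_at intro: has_derivative_continuous)
  obtain n W where W: "open W" "C \<subseteq> W" "odd_separated W n"
    by (rule compact_odd_separated_nhd[OF C(1,2)])
  have "open (W - U)" "C \<subseteq> W - U"
    using W U by (auto intro: open_Diff compact_imp_closed)
  then obtain e where e: "e > 0" "(\<Union>x\<in>C. cball x e) \<subseteq> W - U"
    using compact_subset_open_imp_cball_epsilon_subset[OF C(1)] by metis
  \<comment> \<open>the distance to \<open>C\<close>; \<open>infdist u {}\<close> is \<open>0\<close>, but an empty \<open>C\<close> should be far from every point\<close>
  define g where "g u = (if C = {} then e else infdist u C)" for u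
  define r where "r = e / 4"
  have r: "r > 0" "3 * r < e" "2 * r < 3 * r" using e(1) by (auto simp: r_def)
  have nearC: "u \<in> W \<and> u \<notin> U" if "g u < e" for u
  proof -
    have "C \<noteq> {}" "infdist u C < e" using that by (auto simp: g_def split: if_splits)
    then have "\<exists>d\<in>dist u ` C. d < e" by (intro cInf_lessD) (auto simp: infdist_notempty)
    then have "u \<in> (\<Union>x\<in>C. cball x e)" by (auto simp: dist_commute intro: less_imp_le)
    then show ?thesis using e(2) by blast
  qed
  have gC: "g u = 0" if "u \<in> C" for u using that by (auto simp: g_def)
  have lipg: "g u \<le> g v + dist u v" for u v by (auto simp: g_def infdist_triangle)
  have eveng: "g (- u) = g u" for u
  proof -
    have "dist (- u) ` C = dist u ` C"
    proof -
      have d: "dist (- u) y = dist u (- y)" for y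
        using norm_minus_cancel[of "u + y"] by (simp add: dist_norm)
      have "uminus ` C = C" using C(3) by (auto simp: image_iff) (metis add.inverse_inverse)
      then show ?thesis by (metis (no_types, lifting) d image_cong image_image)
    qed
    then show ?thesis by (simp add: g_def infdist_def)
  qed
  have contg: "continuous_on UNIV g"
    unfolding g_def by (cases "C = {}") (auto intro!: continuous_intros)
  obtain D0 :: "'a \<Rightarrow> 'a" where D0: "continuous_on UNIV D0" "\<And>u. D0 (- u) = - D0 u" "\<And>u. D0 u = 0 \<Longrightarrow> I' u = 0"
    "\<And>u t. 0 \<le> t \<Longrightarrow> t \<le> 1 \<Longrightarrow> I (u + t *\<^sub>R D0 u) \<le> I u - norm (I' u) / 4 * norm (t *\<^sub>R D0 u)"
    using odd_descent_field[OF C1 even] by blast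
  \<comment> \<open>switches the descent off near \<open>C\<close>, where no bound on the slope is available\<close>
  define \<kappa> where "\<kappa> u = min 1 (max 0 (g u - r))" for u
  have chi: "0 \<le> \<kappa> u" "\<kappa> u \<le> 1" for u by (simp_all add: \<kappa>_def)
  define D where "D u = \<kappa> u *\<^sub>R D0 u" for u
  have contD: "continuous_on UNIV D"
    unfolding D_def \<kappa>_def by (intro continuous_intros contg D0(1))
  have oddD: "D (- u) = - D u" for u by (simp add: D_def \<kappa>_def eveng D0(2))
  have desc: "I (u + t *\<^sub>R D u) \<le> I u - a / 4 * norm (t *\<^sub>R D u)"
    if a: "r \<le> g u \<Longrightarrow> a \<le> norm (I' u)" and t: "0 \<le> t" "t \<le> 1" for u t a
  proof (cases "r \<le> g u")
    case True
    have "I (u + (t * \<kappa> u) *\<^sub>R D0 u) \<le> I u - norm (I' u) / 4 * norm ((t * \<kappa> u) *\<^sub>R D0 u)"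
      using t chi[of u] by (intro D0(4)) (auto intro: mult_le_one)
    moreover have "a / 4 * norm ((t * \<kappa> u) *\<^sub>R D0 u) \<le> norm (I' u) / 4 * norm ((t * \<kappa> u) *\<^sub>R D0 u)"
      using a[OF True] by (intro mult_right_mono) auto
    ultimately show ?thesis by (simp add: D_def)
  next
    case False
    then show ?thesis by (simp add: D_def \<kappa>_def)
  qed
  have "\<exists>c>0. \<forall>u\<in>{u. I u \<le> 0} \<inter> {u. r \<le> g u} \<inter> {u. g u \<le> 3 * r}. c \<le> norm (I' u)"
  proof (rule slope_bounded_away_from_zero[OF C1 bdd PS])
    show "closed ({u. I u \<le> 0} \<inter> {u. r \<le> g u} \<inter> {u. g u \<le> 3 * r})"
      by (intro closed_Int closed_Collect_le contI contg continuous_on_const)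
    show "I' u \<noteq> 0" if "u \<in> {u. I u \<le> 0} \<inter> {u. r \<le> g u} \<inter> {u. g u \<le> 3 * r}" for u
      using that crit[of u] nearC[of u] gC[of u] r by auto
  qed auto
  then obtain c where c: "c > 0" "\<And>u. I u \<le> 0 \<Longrightarrow> r \<le> g u \<Longrightarrow> g u \<le> 3 * r \<Longrightarrow> c \<le> norm (I' u)"
    by auto
  have step: "odd_separated {u. I u \<le> b} (k + n)"
    if b: "b < 0" and k: "odd_separated {u. I u \<le> b - c / 4 * r} k" for b k
  proof -
    have "\<exists>a>0. \<forall>u\<in>{u. I u \<le> b} \<inter> {u. r \<le> g u}. a \<le> norm (I' u)"
    proof (rule slope_bounded_away_from_zero[OF C1 bdd PS])
      show "closed ({u. I u \<le> b} \<inter> {u. r \<le> g u})"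
        by (intro closed_Int closed_Collect_le contI contg continuous_on_const)
      show "I' u \<noteq> 0" if "u \<in> {u. I u \<le> b} \<inter> {u. r \<le> g u}" for u
        using that crit[of u] U(3)[of u] gC[of u] r b by auto
    qed (use b in auto)
    then obtain a where a: "a > 0" "\<And>u. I u \<le> b \<Longrightarrow> r \<le> g u \<Longrightarrow> a \<le> norm (I' u)" by auto
    obtain \<eta> where \<eta>: "continuous_on UNIV \<eta>" "\<And>u. \<eta> (- u) = - \<eta> u"
      "\<And>u. I u \<le> b \<Longrightarrow> I (\<eta> u) \<le> b - c / 4 * (3 * r - 2 * r) \<or> g (\<eta> u) \<le> 3 * r"
    proof (rule odd_deformation[OF contI even bdd lipg eveng contD oddD, of "a / 4" b "c / 4" "3 * r" "2 * r"])
      show "I (u + t *\<^sub>R D u) \<le> I u - a / 4 * norm (t *\<^sub>R D u)"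
        if "I u \<le> b" "0 \<le> t" "t \<le> 1" for u t
        by (rule desc) (use that a in auto)
      show "I (u + t *\<^sub>R D u) \<le> I u - c / 4 * norm (t *\<^sub>R D u)"
        if "I u \<le> b" "g u \<le> 3 * r" "0 \<le> t" "t \<le> 1" for u t
        by (rule desc) (use that c b in auto)
      show "g u < 2 * r" if "I u \<le> b" "D u = 0" for u
      proof (cases "\<kappa> u = 0")
        case True
        then show ?thesis using r by (auto simp: \<kappa>_def min_def max_def split: if_splits)
      next
        case False
        then have "I' u = 0" using that D0(3)[of u] by (simp add: D_def)
        then show ?thesis using a(1) a(2)[OF that(1)] r by (cases "r \<le> g u") auto
      qed
    qed (use a c r in auto)
    show ?thesis
    proof (rule odd_separated_vimage[OF odd_separated_Un[OF k W(3)] \<eta>(1,2)])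
      show "\<eta> u \<in> {u. I u \<le> b - c / 4 * r} \<union> W" if "u \<in> {u. I u \<le> b}" for u
        using \<eta>(3)[of u] that nearC[of "\<eta> u"] r by auto
    qed
  qed
  have iter: "odd_separated {u. I u \<le> b} (j * n)" if "b < 0" "b - real j * (c / 4 * r) < m" for b j
    using that
  proof (induction j arbitrary: b)
    case 0
    then have "{u. I u \<le> b} = {}" using bdd by (auto simp: not_le intro: less_le_trans)
    then show ?case by (simp add: odd_separated_empty)
  next
    case (Suc j)
    have pos: "c / 4 * r > 0" using c r by simp
    have "odd_separated {u. I u \<le> b - c / 4 * r} (j * n)"
      using Suc.prems pos by (intro Suc.IH) (auto simp: algebra_simps add_divide_distrib)
    from step[OF Suc.prems(1) this] show ?case by (simp add: add.commute)
  qed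
  obtain j :: nat where j: "- m < real j * (c / 4 * r)"
    using ex_less_of_nat_mult[of "c / 4 * r" "- m"] c r by auto
  show thesis
    by (rule that[of "j * n"], rule iter) (use j in auto)
qed

theorem theorem1p4:
  fixes I :: "'a::banach \<Rightarrow> real" and I' :: "'a \<Rightarrow> 'a \<Rightarrow>\<^sub>L real"
  assumes C1: "C1_functional I I'"
    and A1: "I 0 = 0" "\<And>u. I (- u) = I u" "bdd_below (range I)"
    and A2: "\<And>c. c \<le> 0 \<Longrightarrow> palais_smale I I' c"
    and A3: "\<And>k::nat. k \<ge> 1 \<Longrightarrow>
      \<exists>A\<in>sym_closed_sets. genus A \<ge> enat k \<and> (SUP u\<in>A. ereal (I u)) < 0"
  shows "\<exists>u :: nat \<Rightarrow> 'a.
    (\<forall>j. critical_point I' (u j)) \<and>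
    (\<forall>j. I (u j) < 0) \<and>
    (\<lambda>j. I (u j)) \<longlonglongrightarrow> 0 \<and>
    (\<lambda>j. infdist (u j) (K0_hat I I')) \<longlonglongrightarrow> 0"
proof -
  define H where "H = K0_hat I I'"
  obtain m where bdd: "\<And>u. m \<le> I u" using A1(3) by (auto simp: bdd_below_def)
  have contI: "continuous_on UNIV I" and contI': "continuous_on UNIV I'"
    using C1 by (auto simp: C1_functional_def continuous_on_eq_continuous_at intro: has_derivative_continuous)
  have odd: "I' (- u) = - I' u" for u by (rule C1_functional_deriv_odd[OF C1 A1(2)])
  have closed_crit: "closed {u. I' u = 0}"
    by (intro closed_Collect_eq contI' continuous_on_const)
  have critical_near: "\<exists>u. I' u = 0 \<and> - e < I u \<and> I u < 0 \<and> infdist u H < e" if e: "e > 0" for e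
  proof (rule ccontr)
    assume none: "\<nexists>u. I' u = 0 \<and> - e < I u \<and> I u < 0 \<and> infdist u H < e"
    define Z where "Z = K0 I I'"
    have Z: "Z = {u. I' u = 0} \<inter> {u. I u = 0}" by (auto simp: Z_def K0_def critical_point_def)
    have H: "H = connected_component_set Z 0" by (simp add: H_def K0_hat_def Z_def)
    have clZ: "closed Z"
      unfolding Z by (intro closed_Int closed_crit closed_Collect_eq contI continuous_on_const)
    have cZ: "compact Z"
      by (rule compact_critical_set[OF bdd A2 clZ]) (auto simp: Z)
    have "I' 0 = 0"
      using odd[of 0] scaleR_2[of "I' 0"] by (simp add: eq_neg_iff_add_eq_0)
    then have 0: "0 \<in> Z" using A1(1) by (simp add: Z)
    have symZ: "- u \<in> Z" if "u \<in> Z" for u using that by (simp add: Z odd A1(2))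
    have HZ: "H \<subseteq> Z" "0 \<in> H" using 0 by (auto simp: H connected_component_subset[THEN subsetD])
    have symH: "- u \<in> H" if "u \<in> H" for u
    proof -
      have "uminus ` H \<subseteq> connected_component_set Z 0"
      proof (rule connected_component_maximal)
        show "0 \<in> uminus ` H" using HZ(2) by force
        show "connected (uminus ` H)"
          unfolding H by (intro connected_continuous_image continuous_intros connected_connected_component)
        show "uminus ` H \<subseteq> Z" using HZ symZ by blast
      qed
      then show ?thesis using that unfolding H by blast
    qed
    define W where "W = {u. infdist u H < e}"
    have oW: "open W" unfolding W_def by (intro open_Collect_less continuous_intros)
    have HW: "connected_component_set Z 0 \<subseteq> W" using e by (auto simp: W_def simp flip: H)
    obtain U where U: "H \<subseteq> U" "U \<subseteq> W" "U \<subseteq> Z" "compact U" "compact (Z - U)"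
      using component_clopen_nhd[OF cZ 0 oW HW] unfolding H by blast
    \<comment> \<open>the component \<open>H\<close> is symmetric, so it stays inside the symmetric part of \<open>U\<close>\<close>
    define V where "V = U \<inter> uminus ` U"
    have memV: "u \<in> V \<longleftrightarrow> u \<in> U \<and> - u \<in> U" for u
      unfolding V_def by (auto simp: image_iff) (metis add.inverse_inverse)
    have cV: "compact V"
      unfolding V_def by (intro compact_Int compact_continuous_image continuous_intros U(4))
    have "x \<in> Z - V \<longleftrightarrow> x \<in> (Z - U) \<union> uminus ` (Z - U)" for x
    proof -
      have "x \<in> uminus ` (Z - U) \<longleftrightarrow> - x \<in> Z - U"
        by (metis add.inverse_inverse image_iff)
      then show ?thesis using symZ[of x] symZ[of "- x"] memV[of x] by auto
    qed
    then have "Z - V = (Z - U) \<union> uminus ` (Z - U)" by blast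
    then have cZV: "compact (Z - V)"
      by (auto intro!: compact_Un compact_continuous_image continuous_intros U(5))
    define C where "C = {u. I' u = 0 \<and> I u \<le> 0} - V"
    have VZ: "V \<subseteq> Z" "V \<subseteq> W" using U by (auto simp: memV)
    \<comment> \<open>a union of three closed sets: a point of \<open>C\<close> at a level in \<open>]- e, 0[\<close> is at distance at least \<open>e\<close> from \<open>H\<close>, by the choice of \<open>e\<close>\<close>
    have "C = (Z - V) \<union> {u. I' u = 0} \<inter> {u. I u \<le> - e} \<union> {u. I' u = 0} \<inter> {u. I u \<le> 0} \<inter> {u. e \<le> infdist u H}"
      using VZ none e by (fastforce simp: C_def Z W_def)
    moreover have "closed ((Z - V) \<union> {u. I' u = 0} \<inter> {u. I u \<le> - e} \<union> {u. I' u = 0} \<inter> {u. I u \<le> 0} \<inter> {u. e \<le> infdist u H})"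
      by (intro closed_Un closed_Int closed_crit closed_Collect_le compact_imp_closed[OF cZV] contI continuous_intros)
    ultimately have clC: "closed C" by simp
    have cC: "compact C"
      by (rule compact_critical_set[OF bdd A2 clC]) (auto simp: C_def)
    have "0 \<in> V" using HZ(2) U(1) by (auto simp: memV)
    then have C0: "0 \<notin> C" by (simp add: C_def)
    have symC: "- u \<in> C" if "u \<in> C" for u
      using that by (auto simp: C_def memV odd A1(2))
    obtain M where M: "\<And>b. b < 0 \<Longrightarrow> odd_separated {u. I u \<le> b} M"
    proof (rule sublevel_sets_uniformly_separated[OF C1 A1(2) bdd A2 cC C0 symC cV])
      show "I u = 0" if "u \<in> V" for u using that VZ by (auto simp: Z)
    qed (auto simp: C_def)
    obtain A where A: "A \<in> sym_closed_sets" "genus A \<ge> enat (Suc M)" "(SUP u\<in>A. ereal (I u)) < 0"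
      using A3[of "Suc M"] by (metis le_add1 plus_1_eq_Suc)
    obtain b where b: "(SUP u\<in>A. ereal (I u)) < ereal b" "ereal b < 0"
      using ereal_dense2[OF A(3)] by metis
    have "A \<subseteq> {u. I u \<le> b}"
    proof
      fix u assume "u \<in> A"
      then have "ereal (I u) \<le> (SUP u\<in>A. ereal (I u))" by (rule SUP_upper)
      then have "ereal (I u) < ereal b" using b(1) by (rule le_less_trans)
      then show "u \<in> {u. I u \<le> b}" by simp
    qed
    moreover have "odd_separated {u. I u \<le> b} M" using b(2) by (intro M) simp
    ultimately have "odd_separated A M" by (rule odd_separated_subset[rotated])
    then have "genus A \<le> enat M"
      using A(1) by (intro odd_separated_imp_genus_le) (auto simp: sym_closed_sets_def)
    with A(2) have "enat (Suc M) \<le> enat M" by (rule order_trans)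
    then show False by simp
  qed
  have "\<exists>u. I' u = 0 \<and> - (1 / real (Suc n)) < I u \<and> I u < 0 \<and> infdist u H < 1 / real (Suc n)" for n
    by (rule critical_near) simp
  then obtain u where u: "\<And>n. I' (u n) = 0" "\<And>n. - (1 / real (Suc n)) < I (u n)" "\<And>n. I (u n) < 0"
    "\<And>n. infdist (u n) H < 1 / real (Suc n)" by metis
  have lim: "(\<lambda>n. 1 / real (Suc n)) \<longlonglongrightarrow> 0"
    using LIMSEQ_inverse_real_of_nat by (simp add: inverse_eq_divide)
  have "(\<lambda>n. I (u n)) \<longlonglongrightarrow> 0"
  proof (rule real_tendsto_sandwich)
    show "(\<lambda>n. - (1 / real (Suc n))) \<longlonglongrightarrow> 0" using tendsto_minus[OF lim] by simp
    show "\<forall>\<^sub>F n in sequentially. - (1 / real (Suc n)) \<le> I (u n)"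
      using u(2) by (intro always_eventually allI less_imp_le)
    show "\<forall>\<^sub>F n in sequentially. I (u n) \<le> 0"
      using u(3) by (intro always_eventually allI less_imp_le)
  qed (rule tendsto_const)
  moreover have "(\<lambda>n. infdist (u n) H) \<longlonglongrightarrow> 0"
  proof (rule real_tendsto_sandwich[OF _ _ tendsto_const lim])
    show "\<forall>\<^sub>F n in sequentially. infdist (u n) H \<le> 1 / real (Suc n)"
      using u(4) by (intro always_eventually allI less_imp_le)
  qed (simp add: infdist_nonneg)
  ultimately show ?thesis
    using u(1,3) unfolding H_def critical_point_def by blast
qed

end
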